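(* Let $a,b\in\mathbb{Z}$ be such that $f(x)=x^5+ax+b$ is irreducible in $\mathbb{Z}[x]$, and let $\theta$ be a root of $f$. Suppose that $\dfrac{2^8a^5+5^5b^4}{\gcd(2^8a^5,\,5^5b^4)}$ is square-free. Then $\mathbb{Z}[\theta]$ is the full ring of integers of $\mathbb{Q}(\theta)$ if and only if for each prime $p$ dividing $\gcd(2a,5b)$ one of the following conditions holds: (1) $p\mid a$ and $p\mid b$, but $p^2\nmid b$; (2) $p=2$, $2\nmid a$, and $a+b\equiv 1\pmod 4$; (3) $p=5$, $5\nmid b$, and $b\not\equiv 1+a,\ 7+2a,\ 18+3a,\ 24+4a \pmod{25}$. *)

theory Defs
  imports "HOL-Computational_Algebra.Computational_Algebra" "HOL-Number_Theory.Number_Theory"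
begin

definition int_adjoin :: "complex \<Rightarrow> complex set" where
  "int_adjoin \<theta> = {poly (map_poly of_int p) \<theta> | p :: int poly. True}"

definition rat_field_adjoin :: "complex \<Rightarrow> complex set" where
  "rat_field_adjoin \<theta> =
     {poly (map_poly of_rat p) \<theta> / poly (map_poly of_rat q) \<theta> | p q :: rat poly. True}"

definition ring_of_integers :: "complex set \<Rightarrow> complex set" where
  "ring_of_integers K = {x \<in> K. algebraic_int x}"

end

theory Submission
  imports "Jordan_Normal_Form.Char_Poly" Defs
begin

text \<open>
  For \<open>f = x\<^sup>5 + a x + b\<close> the order \<open>\<int>[\<theta>]\<close> fails to be maximal iff some prime \<open>p\<close> and integer
  \<open>c\<close> satisfy \<open>p\<^sup>2 | f(c)\<close> and \<open>p | f'(c)\<close>; the three conditions describe when this does not happen.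

  Given such \<open>p\<close> and \<open>c\<close>, write \<open>f = (x - c) q + f(c)\<close>; then \<open>q(\<theta>)/p\<close> is integral but not in
  \<open>\<int>[\<theta>]\<close>. Conversely, if \<open>\<int>[\<theta>]\<close> is not maximal, then for some \<open>p\<close> the polynomials \<open>h\<close> with
  \<open>h(\<theta>)/p\<close> integral form an ideal \<open>(p, h)\<close> with \<open>h\<close> monic of degree less than 5, and
  \<open>f = h k + p t\<close>. Integrality makes \<open>h\<close> nilpotent modulo \<open>(p, f)\<close>, hence \<open>(p, h, k)\<close> is a proper
  ideal. It contains \<open>f\<close> and \<open>f'\<close>, hence \<open>5 f - x f' = 4 a x + 5 b\<close>, which forces \<open>h\<close> and \<open>k\<close> to have
  a common root \<open>c\<close> modulo \<open>p\<close>. Then \<open>q(\<theta>)/p\<close> is integral for the above \<open>q\<close>, and \<open>p\<^sup>2 | f(c)\<close> follows.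

  The discriminant \<open>2\<^sup>8 a\<^sup>5 + 5\<^sup>5 b\<^sup>4\<close> lies in the ideal \<open>(f(c), f'(c)\<^sup>2)\<close>, so square-freeness only
  leaves the primes dividing \<open>gcd (2 a) (5 b)\<close>.
\<close>

hide_const (open) module.smult up_ring.coeff up_ring.monom

section \<open>Algebraic integers form a ring\<close>

text \<open>The matrix \<open>A\<close> has eigenvalue \<open>\<alpha>\<close> with eigenvector
  \<open>v\<close>, so its characteristic polynomial, monic with integer coefficients, has
  \<open>\<alpha>\<close> as a root. The index \<open>k\<close> only certifies that \<open>v\<close>
  is nonzero.\<close>

lemma algebraic_int_eigenvalue:
  fixes A :: "nat \<Rightarrow> nat \<Rightarrow> int" and v :: "nat \<Rightarrow> complex"
  assumes "k < n" and "v k \<noteq> 0"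
    and eq: "\<And>i. i < n \<Longrightarrow> \<alpha> * v i = (\<Sum>j<n. of_int (A i j) * v j)"
  shows "algebraic_int \<alpha>"
proof -
  define B where "B = mat n n (\<lambda>(i, j). A i j)"
  define C where "C = (map_mat of_int B :: complex mat)"
  have B: "B \<in> carrier_mat n n" and C: "C \<in> carrier_mat n n"
    by (auto simp: B_def C_def)
  have "eigenvector C (vec n v) \<alpha>"
    unfolding eigenvector_def
  proof (intro conjI)
    show "vec n v \<in> carrier_vec (dim_row C)"
      using C by simp
    have "vec n v $ k \<noteq> 0\<^sub>v n $ k"
      using assms by simp
    thus "vec n v \<noteq> 0\<^sub>v (dim_row C)"
      using C by auto
    show "C *\<^sub>v vec n v = \<alpha> \<cdot>\<^sub>v vec n v"
    proof (rule eq_vecI)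
      fix i assume "i < dim_vec (\<alpha> \<cdot>\<^sub>v vec n v)"
      hence i: "i < n" by simp
      thus "(C *\<^sub>v vec n v) $ i = (\<alpha> \<cdot>\<^sub>v vec n v) $ i"
        using eq[OF i] by (simp add: C_def B_def scalar_prod_def atLeast0LessThan)
    qed (use C in simp)
  qed
  hence "poly (char_poly C) \<alpha> = 0"
    using eigenvalue_root_char_poly[OF C] by (auto simp: eigenvalue_def)
  moreover have "char_poly C = map_poly of_int (char_poly B)"
    unfolding C_def by (rule of_int_hom.char_poly_hom[OF B])
  ultimately show ?thesis
    using degree_monic_char_poly[OF B] unfolding algebraic_int_altdef_ipoly by auto
qed

text \<open>With integer scalars, \<open>int_span.span V\<close> is the additive subgroup of the
  complex numbers generated by \<open>V\<close>.\<close>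

interpretation int_span: Modules.module "\<lambda>n x. of_int n * x :: complex"
  by unfold_locales (auto simp: algebra_simps)

text \<open>The determinant trick: the coefficients of the products \<open>\<alpha> * w\<close> in
  terms of \<open>V\<close> form an integer matrix, and an enumeration of \<open>V\<close> is an
  eigenvector of it for \<open>\<alpha>\<close>.\<close>

lemma algebraic_int_if_stable:
  assumes "finite V" and "v \<in> V" and "v \<noteq> 0"
    and stable: "\<And>w. w \<in> V \<Longrightarrow> \<alpha> * w \<in> int_span.span V"
  shows "algebraic_int \<alpha>"
proof -
  obtain e where e: "bij_betw e {..<card V} V"
    using ex_bij_betw_nat_finite[OF \<open>finite V\<close>] by (auto simp: atLeast0LessThan)
  have "\<exists>c. \<alpha> * w = (\<Sum>u\<in>V. of_int (c u) * u)" if "w \<in> V" for w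
    using stable[OF that] unfolding int_span.span_finite[OF \<open>finite V\<close>] by auto
  then obtain c where c: "\<alpha> * w = (\<Sum>u\<in>V. of_int (c w u) * u)" if "w \<in> V" for w
    by metis
  obtain k where k: "k < card V" "e k = v"
    using e \<open>v \<in> V\<close> by (metis bij_betw_def imageE lessThan_iff)
  show ?thesis
  proof (rule algebraic_int_eigenvalue[of k "card V" e \<alpha> "\<lambda>i j. c (e i) (e j)"])
    fix i assume "i < card V"
    hence "e i \<in> V"
      using e by (auto simp: bij_betw_def)
    thus "\<alpha> * e i = (\<Sum>j<card V. of_int (c (e i) (e j)) * e j)"
      using sum.reindex_bij_betw[OF e, of "\<lambda>u. of_int (c (e i) u) * u"] c by simp
  qed (use k \<open>v \<noteq> 0\<close> in auto)
qed

lemma algebraic_int_power_in_span: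
  assumes "algebraic_int (\<alpha> :: complex)"
  obtains n where "n > 0" and "\<alpha> ^ n \<in> int_span.span ((\<lambda>i. \<alpha> ^ i) ` {..<n})"
proof -
  from assms obtain p where p: "poly (map_poly of_int p) \<alpha> = 0" "lead_coeff p = 1"
    unfolding algebraic_int_altdef_ipoly by blast
  define n where "n = degree p"
  \<comment> \<open>A monic constant polynomial is 1, which has no root.\<close>
  have "n > 0"
    using p by (intro Nat.gr0I) (auto simp: n_def elim!: degree_eq_zeroE)
  have "0 = (\<Sum>i\<le>n. of_int (coeff p i) * \<alpha> ^ i)"
    using p by (simp add: poly_altdef n_def)
  also have "{..n} = insert n {..<n}"
    by auto
  also have "(\<Sum>i\<in>\<dots>. of_int (coeff p i) * \<alpha> ^ i) = \<alpha> ^ n + (\<Sum>i<n. of_int (Polynomial.coeff p i) * \<alpha> ^ i)"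
    using p by (simp add: n_def)
  finally have "\<alpha> ^ n = - (\<Sum>i<n. of_int (coeff p i) * \<alpha> ^ i)"
    by (simp add: add_eq_0_iff)
  also have "\<dots> \<in> int_span.span ((\<lambda>i. \<alpha> ^ i) ` {..<n})"
    by (intro int_span.span_neg int_span.span_sum int_span.span_scale int_span.span_base) auto
  finally show ?thesis
    using that \<open>n > 0\<close> by blast
qed

lemma int_span_mult_subset:
  assumes "x \<in> int_span.span V" and "\<And>v. v \<in> V \<Longrightarrow> c * v \<in> int_span.span W"
  shows "c * x \<in> int_span.span W"
  using assms(1)
proof (induction rule: int_span.span_induct_alt)
  case (step m y z)
  have "c * (of_int m * y + z) = of_int m * (c * y) + c * z"
    by (simp add: algebra_simps)
  also have "\<dots> \<in> int_span.span W"
    using step assms(2) by (intro int_span.span_add int_span.span_scale) auto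
  finally show ?case .
qed (simp add: int_span.span_zero)

text \<open>The monomials \<open>\<alpha> ^ i * \<beta> ^ j\<close> with \<open>i < n\<close> and
  \<open>j < m\<close> generate the lattice. Multiplying by \<open>\<alpha>\<close> leaves this box
  only when \<open>i = n - 1\<close>, and there \<open>\<alpha> ^ n\<close> is rewritten through
  lower powers; likewise for \<open>\<beta>\<close>. One lattice serves for both the sum and the
  product.\<close>

lemma algebraic_int_common_lattice:
  assumes "algebraic_int (\<alpha> :: complex)" and "algebraic_int \<beta>"
  obtains V where "finite V" and "1 \<in> V"
    and "\<And>x. x \<in> int_span.span V \<Longrightarrow> \<alpha> * x \<in> int_span.span V"
    and "\<And>x. x \<in> int_span.span V \<Longrightarrow> \<beta> * x \<in> int_span.span V"
proof -
  obtain n where n: "n > 0" "\<alpha> ^ n \<in> int_span.span ((\<lambda>i. \<alpha> ^ i) ` {..<n})"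
    using algebraic_int_power_in_span[OF assms(1)] .
  obtain m where m: "m > 0" "\<beta> ^ m \<in> int_span.span ((\<lambda>i. \<beta> ^ i) ` {..<m})"
    using algebraic_int_power_in_span[OF assms(2)] .
  define V where "V = (\<lambda>(i, j). \<alpha> ^ i * \<beta> ^ j) ` ({..<n} \<times> {..<m})"
  have V: "\<alpha> ^ i * \<beta> ^ j \<in> V" if "i < n" "j < m" for i j
    using that by (auto simp: V_def)
  have a: "\<alpha> * v \<in> int_span.span V" if "v \<in> V" for v
  proof -
    from that obtain i j where ij: "i < n" "j < m" "v = \<alpha> ^ i * \<beta> ^ j"
      by (auto simp: V_def)
    have "\<beta> ^ j * \<alpha> ^ Suc i \<in> int_span.span V"
    proof (cases "Suc i = n")
      case True
      show ?thesis
        unfolding True using n(2) by (rule int_span_mult_subset)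
          (use V ij in \<open>auto intro!: int_span.span_base simp: mult.commute[of "\<beta> ^ j"]\<close>)
    next
      case False
      thus ?thesis
        using int_span.span_base[OF V[of "Suc i" j]] ij by (simp add: mult.commute)
    qed
    thus ?thesis by (simp add: ij mult_ac)
  qed
  have b: "\<beta> * v \<in> int_span.span V" if "v \<in> V" for v
  proof -
    from that obtain i j where ij: "i < n" "j < m" "v = \<alpha> ^ i * \<beta> ^ j"
      by (auto simp: V_def)
    have "\<alpha> ^ i * \<beta> ^ Suc j \<in> int_span.span V"
    proof (cases "Suc j = m")
      case True
      show ?thesis
        unfolding True using m(2) by (rule int_span_mult_subset)
          (use V ij in \<open>auto intro!: int_span.span_base\<close>)
    next
      case False
      thus ?thesis
        using V[of i "Suc j"] ij by (auto intro!: int_span.span_base)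
    qed
    thus ?thesis by (simp add: ij mult_ac)
  qed
  show ?thesis
  proof (rule that[of V])
    show "finite V" by (simp add: V_def)
    show "1 \<in> V" using V[of 0 0] n m by simp
  qed (use a b int_span_mult_subset in blast)+
qed

lemma algebraic_int_plus:
  assumes "algebraic_int (\<alpha> :: complex)" and "algebraic_int \<beta>"
  shows "algebraic_int (\<alpha> + \<beta>)"
proof -
  obtain V where V: "finite V" "1 \<in> V"
    "\<And>x. x \<in> int_span.span V \<Longrightarrow> \<alpha> * x \<in> int_span.span V"
    "\<And>x. x \<in> int_span.span V \<Longrightarrow> \<beta> * x \<in> int_span.span V"
    using algebraic_int_common_lattice[OF assms] by metis
  thus ?thesis
    by (intro algebraic_int_if_stable[of V 1])
       (auto simp: distrib_right intro!: int_span.span_add intro: int_span.span_base)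
qed

lemma algebraic_int_times:
  assumes "algebraic_int (\<alpha> :: complex)" and "algebraic_int \<beta>"
  shows "algebraic_int (\<alpha> * \<beta>)"
proof -
  obtain V where V: "finite V" "1 \<in> V"
    "\<And>x. x \<in> int_span.span V \<Longrightarrow> \<alpha> * x \<in> int_span.span V"
    "\<And>x. x \<in> int_span.span V \<Longrightarrow> \<beta> * x \<in> int_span.span V"
    using algebraic_int_common_lattice[OF assms] by metis
  thus ?thesis
    by (intro algebraic_int_if_stable[of V 1]) (auto simp: mult.assoc intro: int_span.span_base)
qed

lemma algebraic_int_int_poly:
  assumes "algebraic_int (\<alpha> :: complex)"
  shows "algebraic_int (poly (map_poly of_int p) \<alpha>)"
  by (induction p) (auto simp: of_int_hom.map_poly_pCons_hom
      intro!: algebraic_int_plus algebraic_int_times assms)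

section \<open>Integer polynomials\<close>

lemma rat_poly_clear_denominator:
  obtains d :: int and h where "d \<noteq> 0"
    and "map_poly of_rat (smult (of_int d) q) = (map_poly of_int h :: complex poly)"
proof -
  have "\<exists>d h. d \<noteq> 0 \<and> smult (of_int d) q = map_poly of_int h" for q :: "rat poly"
  proof (induction q)
    case 0
    show ?case by (intro exI[of _ 1] exI[of _ 0]) auto
  next
    case (pCons a q)
    then obtain d h where dh: "d \<noteq> 0" "smult (of_int d) q = map_poly of_int h"
      by blast
    obtain m n :: int where a: "a = of_int m / of_int n" "n > 0"
      by (metis quotient_of_denom_pos' quotient_of_div prod.collapse)
    have "smult (of_int (n * d)) (pCons a q) = map_poly of_int (pCons (d * m) (smult n h))"
      using a dh(2)[symmetric] by (simp add: hom_distribs)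
    moreover have "n * d \<noteq> 0"
      using a dh by simp
    ultimately show ?case by blast
  qed
  then obtain d h where dh: "d \<noteq> 0" "smult (of_int d) q = map_poly of_int h"
    by blast
  show ?thesis
    by (rule that[of d h]) (use dh in \<open>auto simp: map_poly_map_poly o_def\<close>)
qed

lemma monic_division:
  fixes f g :: "'a :: comm_ring_1 poly"
  assumes "lead_coeff g = 1"
  obtains q r where "f = g * q + r" and "r = 0 \<or> degree r < degree g"
proof -
  obtain q r where "pseudo_divmod f g = (q, r)"
    by fastforce
  moreover have "g \<noteq> 0"
    using assms by auto
  ultimately show ?thesis
    using pseudo_divmod[of g f q r] that assms by auto
qed

section \<open>Common roots modulo a prime\<close>

lemma prime_bezout_int:
  fixes p n :: int
  assumes "prime p" and "\<not> p dvd n"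
  obtains d e where "d * n + e * p = 1"
proof -
  have "gcd n p = 1"
    using prime_imp_coprime[OF assms] by (simp add: coprime_iff_gcd_eq_1 gcd.commute)
  thus ?thesis
    using that bezout_int[of n p] by auto
qed


text \<open>If \<open>c\<close> is not a common root of \<open>h\<close> and \<open>k\<close> modulo
  \<open>p\<close>, then \<open>x - c\<close> is a unit modulo the ideal \<open>(p, h, k)\<close>.
  If this held for every factor of a product lying in the ideal, all of them could be cancelled and
  the ideal would contain 1.\<close>

lemma ex_common_root_mod_prime:
  fixes h k :: "int poly"
  assumes p: "prime p"
    and proper: "\<forall>u v w. u * h + v * k + smult p w \<noteq> 1"
    and "(\<Prod>c\<leftarrow>cs. [:- c, 1:]) = u * h + v * k + smult p w"
  shows "\<exists>c\<in>set cs. p dvd poly h c \<and> p dvd poly k c"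
proof -
  define J where "J = {u * h + v * k + smult p w | u v w. True}"
  have JI: "u * h + v * k + smult p w \<in> J" for u v w
    by (auto simp: J_def)
  have add: "x + y \<in> J" if xy: "x \<in> J" "y \<in> J" for x y
  proof -
    obtain u v w u' v' w' where
      "x = u * h + v * k + smult p w" "y = u' * h + v' * k + smult p w'"
      using xy unfolding J_def by blast
    hence "x + y = (u + u') * h + (v + v') * k + smult p (w + w')"
      by (simp add: algebra_simps smult_add_right)
    thus ?thesis using JI by metis
  qed
  have mult: "s * x \<in> J" if x: "x \<in> J" for s x
  proof -
    obtain u v w where "x = u * h + v * k + smult p w"
      using x unfolding J_def by blast
    hence "s * x = (s * u) * h + (s * v) * k + smult p (s * w)"
      by (simp add: algebra_simps)
    thus ?thesis using JI by metis
  qed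
  have hJ: "h \<in> J" and kJ: "k \<in> J" and pJ: "smult p w \<in> J" for w
    using JI[of 1 0 0] JI[of 0 1 0] JI[of 0 0 w] by auto
  have "1 \<notin> J"
    using proper by (auto simp: J_def dest: sym)
  \<comment> \<open>Since \<open>g = (x - c) g' + g(c)\<close> lies in \<open>J\<close>, the product
    \<open>(x - c) g'\<close> is congruent to \<open>- g(c)\<close>, which is invertible modulo
    \<open>p\<close>; hence \<open>x - c\<close> can be cancelled modulo \<open>J\<close>.\<close>
  have cancel: "m \<in> J" if g: "g \<in> J" "\<not> p dvd poly g c" and m: "[:- c, 1:] * m \<in> J" for g c m
  proof -
    obtain d e where de: "d * poly g c + e * p = 1"
      using prime_bezout_int[OF p g(2)] .
    define g' where "g' = synthetic_div g c"
    have g': "[:- c, 1:] * g' + [:poly g c:] = g"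
      unfolding g'_def by (rule synthetic_div_correct')
    have "m = [:d * poly g c + e * p:] * m"
      by (simp add: de)
    also have "\<dots> = smult d m * [:poly g c:] + smult p (smult e m)"
      by (simp add: smult_add_left mult_ac)
    also have "[:poly g c:] = g - [:- c, 1:] * g'"
      using g' by (simp add: eq_diff_eq add.commute)
    also have "smult d m * (g - [:- c, 1:] * g') = smult d m * g + (- smult d g') * ([:- c, 1:] * m)"
      by (simp add: right_diff_distrib mult_ac del: mult_pCons_left mult_pCons_right)
    finally show ?thesis
      using add mult g(1) m pJ by metis
  qed
  have "\<exists>c\<in>set cs. p dvd poly h c \<and> p dvd poly k c" if "(\<Prod>c\<leftarrow>cs. [:- c, 1:]) \<in> J"
    using that
  proof (induction cs)
    case Nil
    with \<open>1 \<notin> J\<close> show ?case by simp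
  next
    case (Cons c cs)
    hence m: "[:- c, 1:] * (\<Prod>c\<leftarrow>cs. [:- c, 1:]) \<in> J"
      by simp
    show ?case
    proof (cases "p dvd poly h c \<and> p dvd poly k c")
      case False
      hence "(\<Prod>c\<leftarrow>cs. [:- c, 1:]) \<in> J"
        using cancel[OF hJ _ m] cancel[OF kJ _ m] by blast
      from Cons.IH[OF this] show ?thesis by auto
    qed auto
  qed
  moreover have "(\<Prod>c\<leftarrow>cs. [:- c, 1:]) \<in> J"
    unfolding assms(3) by (rule JI)
  ultimately show ?thesis by blast
qed

section \<open>Maximality of monogenic orders\<close>

locale monic_irreducible_root =
  fixes f :: "int poly" and \<theta> :: complex
  assumes monic: "lead_coeff f = 1"
    and irred: "irreducible f"
    and root: "poly (map_poly of_int f) \<theta> = 0"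
begin

abbreviation ev :: "int poly \<Rightarrow> complex" where
  "ev h \<equiv> poly (map_poly of_int h) \<theta>"

section \<open>The kernel of evaluation at the root, and denominators\<close>

lemma degree_pos: "degree f > 0"
proof (rule Nat.gr0I)
  assume "degree f = 0"
  hence "f = 1"
    using monic by (auto elim!: degree_eq_zeroE simp: one_pCons)
  thus False
    using irred by simp
qed

text \<open>Bezout over the rationals with denominators cleared. A nonzero combination
  \<open>g\<close> of least degree divides \<open>f\<close> and \<open>Q\<close> up to nonzero
  constants. The prime \<open>f\<close> divides \<open>g * q = smult c f\<close> but not
  \<open>g\<close>, hence divides \<open>q\<close>; cancelling \<open>f\<close> shows that
  \<open>g\<close> divides a nonzero constant.\<close>

lemma bezout_const:
  assumes "\<not> f dvd Q"
  obtains u v m where "m \<noteq> 0" and "u * Q + v * f = [:m:]"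
proof -
  define S where "S = {g. g \<noteq> 0 \<and> (\<exists>u v. g = u * Q + v * f)}"
  have fS: "f \<in> S"
  proof -
    have "f = 0 * Q + 1 * f" by simp
    moreover have "f \<noteq> 0" using monic by auto
    ultimately show ?thesis unfolding S_def by blast
  qed
  obtain g where g: "g \<in> S" "\<And>h. h \<in> S \<Longrightarrow> degree g \<le> degree h"
    using ex_has_least_nat[of "\<lambda>g. g \<in> S" f degree] fS by blast
  from g obtain u v where uv: "g = u * Q + v * f" and "g \<noteq> 0"
    by (auto simp: S_def)
  \<comment> \<open>The pseudo-remainder of a combination by \<open>g\<close> is again a
    combination, of smaller degree, so it vanishes by minimality.\<close>
  have dvd: "\<exists>c q. c \<noteq> 0 \<and> smult c h = g * q" if h: "h = s * Q + t * f" for h s t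
  proof -
    define c where "c = lead_coeff g ^ (Suc (degree h) - degree g)"
    have "c \<noteq> 0"
      using \<open>g \<noteq> 0\<close> by (simp add: c_def)
    obtain q r where "pseudo_divmod h g = (q, r)"
      by fastforce
    from pseudo_divmod[OF \<open>g \<noteq> 0\<close> this]
    have qr: "smult c h = g * q + r" "r = 0 \<or> degree r < degree g"
      by (simp_all add: c_def)
    have "r = smult c h - g * q"
      using qr by simp
    also have "\<dots> = (smult c s - u * q) * Q + (smult c t - v * q) * f"
      unfolding h uv by (simp add: algebra_simps smult_add_right)
    finally have "r \<in> S" if "r \<noteq> 0"
      using that unfolding S_def by blast
    hence "r = 0"
      using g(2) qr(2) by fastforce
    thus ?thesis
      using qr(1) \<open>c \<noteq> 0\<close> by auto
  qed
  have prime: "prime_elem f"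
    using irred by (rule irreducible_imp_prime_elem)
  have f_const: "f dvd h" if "f dvd smult c h" "c \<noteq> 0" for c h
  proof -
    have "f dvd [:c:] * h"
      using that by simp
    moreover have "\<not> f dvd [:c:]"
      using degree_pos that(2) by (auto dest!: dvd_imp_degree_le)
    ultimately show ?thesis
      using prime_elem_dvd_mult_iff[OF prime] by blast
  qed
  obtain c q where cq: "c \<noteq> 0" "smult c f = g * q"
    using dvd[of f 0 1] by auto
  have "f dvd g * q"
    using cq(2)[symmetric] by (simp add: dvd_smult)
  moreover have "\<not> f dvd g"
  proof
    assume "f dvd g"
    moreover obtain d r where d: "d \<noteq> 0" "smult d Q = g * r"
      using dvd[of Q 1 0] by auto
    ultimately have "f dvd smult d Q"
      by simp
    with d(1) f_const assms show False by blast
  qed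
  ultimately obtain q' where "q = f * q'"
    using prime by (auto simp: prime_elem_dvd_mult_iff)
  hence "f * [:c:] = f * (g * q')"
    using cq(2) by (simp add: mult_ac)
  hence "[:c:] = g * q'"
    using monic mult_left_cancel[of f "[:c:]" "g * q'"] by fastforce
  hence "degree g = 0"
    using cq(1) by (metis add_is_0 degree_mult_eq degree_pCons_0 mult_zero_left mult_zero_right pCons_eq_0_iff)
  then obtain m where "g = [:m:]"
    by (auto elim: degree_eq_zeroE)
  with \<open>g \<noteq> 0\<close> uv show ?thesis
    by (intro that[of m u v]) auto
qed

text \<open>If \<open>f\<close> did not divide \<open>Q\<close>, evaluating the relation of
  \<open>bezout_const\<close> at \<open>\<theta>\<close> would make a nonzero integer equal to
  0.\<close>

lemma ev_eq_0_iff: "ev Q = 0 \<longleftrightarrow> f dvd Q"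
proof
  assume *: "ev Q = 0"
  show "f dvd Q"
  proof (rule ccontr)
    assume "\<not> f dvd Q"
    then obtain u v m where "m \<noteq> 0" and "u * Q + v * f = [:m:]"
      by (rule bezout_const)
    from arg_cong[OF this(2), of ev] this(1) * root show False
      by (simp add: hom_distribs)
  qed
qed (auto simp: hom_distribs root)

lemma algebraic_int_\<theta>: "algebraic_int \<theta>"
  using root monic unfolding algebraic_int_altdef_ipoly by blast

lemma rat_field_adjoin_clear_denominator:
  assumes "x \<in> rat_field_adjoin \<theta>"
  obtains m h where "m \<noteq> 0" and "of_int m * x = ev h"
proof -
  obtain P Q where x: "x = poly (map_poly of_rat P) \<theta> / poly (map_poly of_rat Q) \<theta>"
    using assms by (auto simp: rat_field_adjoin_def)
  obtain d h where d: "d \<noteq> 0" "map_poly of_rat (smult (of_int d) P) = (map_poly of_int h :: complex poly)"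
    by (rule rat_poly_clear_denominator)
  obtain e k where e: "e \<noteq> 0" "map_poly of_rat (smult (of_int e) Q) = (map_poly of_int k :: complex poly)"
    by (rule rat_poly_clear_denominator)
  have h: "ev h = of_int d * poly (map_poly of_rat P) \<theta>"
    unfolding d(2)[symmetric] by (simp add: of_rat_hom.map_poly_hom_smult)
  have k: "ev k = of_int e * poly (map_poly of_rat Q) \<theta>"
    unfolding e(2)[symmetric] by (simp add: of_rat_hom.map_poly_hom_smult)
  show ?thesis
  proof (cases "ev k = 0")
    \<comment> \<open>Division by zero yields 0, so \<open>x = 0\<close> in this case.\<close>
    case True
    thus ?thesis
      using that[of 1 0] x k e(1) by simp
  next
    case False
    \<comment> \<open>Evaluated at \<open>\<theta>\<close>, the relation says that
      \<open>ev u\<close> inverts the denominator \<open>ev k\<close> up to the integer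
      \<open>m\<close>.\<close>
    then obtain u v m where m: "m \<noteq> 0" "u * k + v * f = [:m:]"
      using bezout_const ev_eq_0_iff by metis
    from arg_cong[OF this(2), of ev] root have um: "ev u * ev k = of_int m"
      by (simp add: hom_distribs)
    have "of_int (d * m) * x = of_int d * (ev u * ev k) * x"
      by (simp add: um)
    also have "\<dots> = ev (smult e u * h)"
      using False e(1) by (simp add: x h k hom_distribs)
    finally show ?thesis
      using that[of "d * m"] m d by simp
  qed
qed

lemma int_adjoin_iff: "x \<in> int_adjoin \<theta> \<longleftrightarrow> (\<exists>h. x = ev h)"
  by (auto simp: int_adjoin_def)

lemma int_adjoin_subset: "int_adjoin \<theta> \<subseteq> ring_of_integers (rat_field_adjoin \<theta>)"
proof
  fix x assume "x \<in> int_adjoin \<theta>"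
  then obtain h where h: "x = ev h"
    by (auto simp: int_adjoin_iff)
  have "x = poly (map_poly of_rat (map_poly of_int h)) \<theta> / poly (map_poly of_rat 1) \<theta>"
    by (simp add: h map_poly_map_poly o_def)
  hence "x \<in> rat_field_adjoin \<theta>"
    unfolding rat_field_adjoin_def by blast
  thus "x \<in> ring_of_integers (rat_field_adjoin \<theta>)"
    by (simp add: ring_of_integers_def h algebraic_int_int_poly algebraic_int_\<theta>)
qed

section \<open>Failure of maximality at a prime\<close>

text \<open>For an integral \<open>x\<close> outside the order, let \<open>n\<close> be the least
  positive integer with \<open>n * x\<close> in the order. For a prime \<open>q\<close> dividing
  \<open>n\<close>, the element \<open>(n / q) * x\<close> is still integral and, by minimality,
  outside the order, while \<open>q\<close> times it lies inside.\<close>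

lemma not_maximal_prime:
  assumes "int_adjoin \<theta> \<noteq> ring_of_integers (rat_field_adjoin \<theta>)"
  obtains p h where "prime p" and "algebraic_int (ev h / of_int p)" and "ev h / of_int p \<notin> int_adjoin \<theta>"
proof -
  from assms int_adjoin_subset obtain x where
    x: "x \<in> rat_field_adjoin \<theta>" "algebraic_int x" "x \<notin> int_adjoin \<theta>"
    unfolding ring_of_integers_def by blast
  define P where "P m \<longleftrightarrow> m > 0 \<and> of_nat m * x \<in> int_adjoin \<theta>" for m :: nat
  obtain m h where mh: "m \<noteq> 0" "of_int m * x = ev h"
    using rat_field_adjoin_clear_denominator[OF x(1)] .
  have "of_nat (nat \<bar>m\<bar>) * x = ev (smult (sgn m) h)"
    using mh by (auto simp: hom_distribs abs_if sgn_if simp flip: mh(2))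
  hence "P (nat \<bar>m\<bar>)"
    using mh(1) unfolding P_def int_adjoin_iff by auto
  then obtain n where n: "P n" "\<And>k. P k \<Longrightarrow> n \<le> k"
    using ex_has_least_nat[of P _ "\<lambda>n. n"] by auto
  have "n \<noteq> 1"
    using n(1) x(3) by (auto simp: P_def)
  then obtain q where q: "prime q" "q dvd n"
    using prime_factor_nat by blast
  then obtain k where k: "n = q * k" by blast
  have "k < n" "k > 0" "q > 0"
    using n(1) q(1) prime_gt_1_nat[OF q(1)] by (auto simp: P_def k)
  hence "of_nat k * x \<notin> int_adjoin \<theta>"
    using n(2)[of k] by (auto simp: P_def)
  moreover obtain h where "of_nat n * x = ev h"
    using n(1) by (auto simp: P_def int_adjoin_iff)
  hence "of_nat k * x = ev h / of_int (int q)"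
    using \<open>q > 0\<close> by (auto simp: k field_simps)
  moreover have "algebraic_int (of_nat k * x)"
    using x(2) by (intro algebraic_int_times) auto
  moreover have "prime (int q)"
    using q by simp
  ultimately show ?thesis
    using that by metis
qed

text \<open>The powers of \<open>\<theta>\<close> below \<open>degree f\<close> are independent:
  after reducing \<open>w\<close> modulo \<open>f\<close> to \<open>r\<close>, the difference
  \<open>h - smult p r\<close> is a multiple of \<open>f\<close> of smaller degree, hence
  zero.\<close>

lemma const_dvd_if_ev_multiple:
  assumes "degree h < degree f" and "ev h = of_int p * ev w"
  shows "[:p:] dvd h"
proof -
  obtain q r where qr: "w = f * q + r" "r = 0 \<or> degree r < degree f"
    using monic_division[OF monic] .
  have "ev (h - smult p r) = 0"
    using assms(2) root by (simp add: qr(1) hom_distribs)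
  hence "f dvd h - smult p r"
    by (simp only: ev_eq_0_iff)
  moreover have "degree (h - smult p r) < degree f"
    using assms(1) qr(2) degree_pos by (intro degree_diff_less) auto
  ultimately have "h - smult p r = 0"
    using dvd_imp_degree_le[of f "h - smult p r"] by fastforce
  hence "h = smult p r"
    by simp
  thus ?thesis
    by (simp add: const_poly_dvd_iff)
qed

text \<open>With \<open>f = (x - c) q + f(c)\<close>, the element \<open>y = q(\<theta>)/p\<close> satisfies
  \<open>y\<^sup>2 - (f'(c)/p) y \<in> \<int>[\<theta>]\<close>.\<close>

lemma not_maximal_if_double_root:
  assumes p: "prime p" and fc: "p ^ 2 dvd poly f c" and f'c: "p dvd poly (pderiv f) c"
  shows "int_adjoin \<theta> \<noteq> ring_of_integers (rat_field_adjoin \<theta>)"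
proof -
  have p0: "p \<noteq> 0" and p1: "\<not> p dvd 1"
    using p by (auto simp: not_prime_unit)
  define q where "q = synthetic_div f c"
  define q1 where "q1 = synthetic_div q c"
  have f: "f = [:- c, 1:] * q + [:poly f c:]"
    unfolding q_def by (rule synthetic_div_correct'[symmetric])
  have q: "q = [:- c, 1:] * q1 + [:poly q c:]"
    unfolding q1_def by (rule synthetic_div_correct'[symmetric])
  have "pderiv f = q + [:- c, 1:] * pderiv q"
    by (subst f) (simp only: pderiv_add pderiv_mult, simp add: pderiv_pCons)
  \<comment> \<open>The term with the factor \<open>x - c\<close> vanishes at
    \<open>c\<close>.\<close>
  hence "poly q c = poly (pderiv f) c"
    by simp
  then obtain r where r: "poly q c = p * r"
    using f'c by auto
  obtain m where m: "poly f c = p ^ 2 * m"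
    using fc by auto
  define y where "y = ev q / of_int p"
  have "ev f = (\<theta> - of_int c) * ev q + of_int (p ^ 2 * m)"
    by (subst f) (simp add: hom_distribs m algebra_simps)
  hence 1: "(\<theta> - of_int c) * ev q = - of_int (p ^ 2 * m)"
    using root by (simp add: add_eq_0_iff)
  have 2: "ev q = (\<theta> - of_int c) * ev q1 + of_int (p * r)"
    by (subst q) (simp add: hom_distribs r algebra_simps)
  have "ev q * ev q = ev q * ((\<theta> - of_int c) * ev q1 + of_int (p * r))"
    by (rule arg_cong[OF 2])
  also have "\<dots> = (\<theta> - of_int c) * ev q * ev q1 + of_int (p * r) * ev q"
    by (simp only: distrib_left mult_ac)
  also have "\<dots> = of_int (p ^ 2) * (- of_int m * ev q1) + of_int (p * r) * ev q"
    unfolding 1 by simp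
  finally have "ev q * ev q - of_int (p * r) * ev q = of_int (p ^ 2) * (- of_int m * ev q1)"
    by (simp only: add_diff_cancel_right')
  moreover have "ev q = of_int p * y"
    using p0 by (simp add: y_def)
  hence "ev q * ev q - of_int (p * r) * ev q = of_int (p ^ 2) * (y * y - of_int r * y)"
    by (simp only: of_int_mult of_int_power power2_eq_square right_diff_distrib mult_ac)
  ultimately have "y * y - of_int r * y = - of_int m * ev q1"
    using p0 by (metis mult_left_cancel of_int_eq_0_iff power_not_zero)
  moreover have "algebraic_int (- of_int m * ev q1)"
    by (intro algebraic_int_times algebraic_int_int_poly algebraic_int_\<theta> algebraic_int_minus) auto
  ultimately obtain P where P: "poly (map_poly of_int P) (y * y - of_int r * y) = 0" "lead_coeff P = 1"
    unfolding algebraic_int_altdef_ipoly by metis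
  \<comment> \<open>Substituting the monic \<open>x^2 - r x\<close> into the monic equation of
    \<open>y * y - of_int r * y\<close> gives a monic equation for \<open>y\<close>.\<close>
  define Q where "Q = P \<circ>\<^sub>p [:0, - r, 1:]"
  have "lead_coeff Q = 1"
    unfolding Q_def using P(2) by (subst lead_coeff_comp) auto
  moreover have "poly (map_poly of_int Q) y = 0"
    unfolding Q_def of_int_hom.map_poly_pcompose poly_pcompose
    using P(1) by (simp add: hom_distribs algebra_simps)
  ultimately have "algebraic_int y"
    unfolding algebraic_int_altdef_ipoly by blast
  moreover have "y = poly (map_poly of_rat (map_poly of_int q)) \<theta> / poly (map_poly of_rat [:of_int p:]) \<theta>"
    by (simp add: y_def map_poly_map_poly o_def hom_distribs)
  hence "y \<in> rat_field_adjoin \<theta>"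
    unfolding rat_field_adjoin_def by blast
  moreover have "y \<notin> int_adjoin \<theta>"
  proof
    assume "y \<in> int_adjoin \<theta>"
    then obtain w where "y = ev w"
      by (auto simp: int_adjoin_iff)
    hence "ev q = of_int p * ev w"
      using p0 by (simp add: y_def field_simps)
    moreover have "degree q < degree f"
      unfolding q_def using degree_pos by (simp add: degree_synthetic_div)
    ultimately have "[:p:] dvd q"
      by (intro const_dvd_if_ev_multiple)
    \<comment> \<open>The contradiction: \<open>p\<close> would divide all coefficients of
      \<open>f - f(c)\<close>, but its leading coefficient is 1.\<close>
    hence "[:p:] dvd [:- c, 1:] * q"
      by (rule dvd_mult)
    hence "p dvd coeff ([:- c, 1:] * q) (degree f)"
      by (simp only: const_poly_dvd_iff)
    also have "[:- c, 1:] * q = f - [:poly f c:]"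
      by (subst f) simp
    also have "coeff \<dots> (degree f) = 1"
      using monic degree_pos by (auto simp: coeff_pCons split: nat.splits)
    finally show False
      using p1 by simp
  qed
  ultimately show ?thesis
    unfolding ring_of_integers_def by blast
qed

text \<open>Let \<open>y = ev h / p\<close>. Some \<open>y ^ n\<close> is an integer combination of
  lower powers, so the single factor \<open>p ^ (n - 1)\<close> clears all denominators. Since
  \<open>ev h ^ n = p ^ n * y ^ n\<close>, one factor \<open>p\<close> is left over; thus
  \<open>h\<close> is nilpotent modulo \<open>(p, f)\<close>.\<close>

lemma power_ev_multiple:
  assumes "p \<noteq> 0" and "algebraic_int (ev h / of_int p)"
  obtains n W where "n > 0" and "ev h ^ n = of_int p * ev W"
proof -
  define y where "y = ev h / of_int p"
  have h: "ev h = of_int p * y"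
    using assms(1) by (simp add: y_def)
  obtain n where n: "n > 0" "y ^ n \<in> int_span.span ((\<lambda>i. y ^ i) ` {..<n})"
    using algebraic_int_power_in_span[OF assms(2)] unfolding y_def by metis
  have *: "\<exists>W. of_int p ^ (n - 1) * z = ev W" if "z \<in> int_span.span ((\<lambda>i. y ^ i) ` {..<n})" for z
    using that
  proof (induction rule: int_span.span_induct_alt)
    case base
    show ?case by (intro exI[of _ 0]) simp
  next
    case (step c z x)
    obtain W where W: "of_int p ^ (n - 1) * x = ev W"
      using step by blast
    obtain i where i: "i < n" "z = y ^ i"
      using step by blast
    have "of_int p ^ (n - 1) * z = of_int (p ^ (n - 1 - i)) * ev (h ^ i)"
      using i by (simp add: h hom_distribs power_mult_distrib flip: power_add)
    hence "of_int p ^ (n - 1) * (of_int c * z + x) = ev (smult (c * p ^ (n - 1 - i)) (h ^ i) + W)"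
      unfolding distrib_left mult.left_commute[of _ "of_int c"] W by (simp add: hom_distribs)
    thus ?case by blast
  qed
  obtain W where "of_int p ^ (n - 1) * y ^ n = ev W"
    using *[OF n(2)] by blast
  hence "of_int p * ev W = of_int p ^ Suc (n - 1) * y ^ n"
    by simp
  hence "ev h ^ n = of_int p * ev W"
    using n(1) by (simp add: h power_mult_distrib)
  with n(1) that show ?thesis by blast
qed

lemma not_maximal_factorization:
  assumes "int_adjoin \<theta> \<noteq> ring_of_integers (rat_field_adjoin \<theta>)"
  obtains p h k t where "prime p" and "f = h * k + smult p t"
    and "algebraic_int (ev h / of_int p)"
    and "\<forall>u v w. u * h + v * k + smult p w \<noteq> 1"
proof -
  obtain p h0 where p: "prime p"
    and h0: "algebraic_int (ev h0 / of_int p)" "ev h0 / of_int p \<notin> int_adjoin \<theta>"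
    using not_maximal_prime[OF assms] by metis
  have p0: "p \<noteq> 0" and p1: "\<not> p dvd 1"
    using p by (auto simp: not_prime_unit)
  \<comment> \<open>\<open>I\<close> is an ideal containing \<open>p\<close> and \<open>f\<close>. A
    member of least degree not divisible by \<open>p\<close> can be made monic, and the remainder of
    \<open>f\<close> on division by it is again in \<open>I\<close>, hence divisible by
    \<open>p\<close>.\<close>
  define I where "I = {h. algebraic_int (ev h / of_int p)}"
  have add: "g + h \<in> I" if "g \<in> I" "h \<in> I" for g h
    using that by (auto simp: I_def hom_distribs add_divide_distrib intro: algebraic_int_plus)
  have mult: "s * h \<in> I" if "h \<in> I" for s h
    using algebraic_int_times[OF algebraic_int_int_poly[OF algebraic_int_\<theta>, of s], of "ev h / of_int p"] that
    by (simp add: I_def hom_distribs)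
  have pI: "smult p w \<in> I" for w
    using p0 by (auto simp: I_def hom_distribs intro: algebraic_int_int_poly algebraic_int_\<theta>)
  define S where "S = {h \<in> I. \<not> [:p:] dvd h}"
  obtain q r where qr: "h0 = f * q + r" "r = 0 \<or> degree r < degree f"
    using monic_division[OF monic] .
  have ev_r: "ev r = ev h0"
    using root by (simp add: qr hom_distribs)
  have r_dvd: "\<not> [:p:] dvd r"
  proof
    assume "[:p:] dvd r"
    then obtain w where "r = smult p w"
      by (auto elim!: dvdE)
    hence "ev h0 / of_int p = ev w"
      unfolding ev_r[symmetric] using p0 by (simp add: hom_distribs)
    with h0(2) show False
      unfolding int_adjoin_iff by blast
  qed
  hence "r \<in> S" and "degree r < degree f"
    using h0(1) ev_r qr(2) by (auto simp: S_def I_def)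
  obtain g where g: "g \<in> S" "\<And>h. h \<in> S \<Longrightarrow> degree g \<le> degree h"
    using ex_has_least_nat[of "\<lambda>g. g \<in> S" r degree] \<open>r \<in> S\<close> by blast
  have min: "[:p:] dvd h" if "h \<in> I" "h = 0 \<or> degree h < degree g" for h
    using g(2)[of h] that unfolding S_def by fastforce
  have lc: "\<not> p dvd lead_coeff g"
  proof
    assume "p dvd lead_coeff g"
    then obtain l where l: "lead_coeff g = p * l" by blast
    \<comment> \<open>Removing the leading term by a multiple of \<open>p\<close> stays in
      \<open>I\<close> and lowers the degree, so minimality would force \<open>p\<close> to divide
      \<open>g\<close>.\<close>
    define g' where "g' = g + smult p (- monom l (degree g))"
    have "g' \<in> I"
      unfolding g'_def using g(1) by (intro add pI) (auto simp: S_def)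
    moreover have "g' = 0 \<or> degree g' < degree g"
    proof -
      have "degree g' \<le> degree g"
        unfolding g'_def by (intro degree_add_le) (auto intro!: order.trans[OF degree_smult_le] degree_monom_le)
      moreover have "coeff g' (degree g) = 0"
        by (simp add: g'_def l)
      ultimately show ?thesis
        using degree_less_if_less_eqI by blast
    qed
    ultimately have "[:p:] dvd g'"
      by (rule min)
    moreover have "[:p:] dvd smult p (monom l (degree g))"
      by (simp add: const_poly_dvd_iff)
    ultimately have "[:p:] dvd g' + smult p (monom l (degree g))"
      by (rule dvd_add)
    hence "[:p:] dvd g"
      by (simp add: g'_def)
    thus False
      using g(1) by (simp add: S_def)
  qed
  obtain d e where de: "d * lead_coeff g + e * p = 1"
    using prime_bezout_int[OF p lc] .
  \<comment> \<open>The leading coefficient becomes \<open>d * lead_coeff g + e * p = 1\<close>, at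
    the cost of a multiple of \<open>p\<close> only.\<close>
  define h where "h = [:d:] * g + smult p (monom e (degree g))"
  have hI: "h \<in> I"
    unfolding h_def using g(1) by (intro add mult pI) (auto simp: S_def)
  have "degree h \<le> degree g"
    unfolding h_def by (intro degree_add_le) (auto intro!: order.trans[OF degree_smult_le] degree_monom_le)
  moreover have "coeff h (degree g) = 1"
    using de by (simp add: h_def mult_ac)
  ultimately have deg_h: "degree h = degree g" and monic_h: "lead_coeff h = 1"
    by (metis le_antisym le_degree one_neq_zero)+
  have "degree h < degree f"
    using deg_h g(2)[OF \<open>r \<in> S\<close>] \<open>degree r < degree f\<close> by simp
  obtain k r' where k: "f = h * k + r'" "r' = 0 \<or> degree r' < degree h"
    using monic_division[OF monic_h] .
  have "f \<in> I"
    using root by (simp add: I_def)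
  hence "f + (- k) * h \<in> I"
    by (intro add mult hI)
  hence "r' \<in> I"
    by (subst (asm) k(1)) (simp add: algebra_simps)
  with k(2) have "[:p:] dvd r'"
    unfolding deg_h by (intro min)
  then obtain t where "r' = smult p t"
    by (auto elim!: dvdE)
  hence f: "f = h * k + smult p t"
    using k(1) by simp
  have "u * h + v * k + smult p w \<noteq> 1" for u v w
  proof
    assume *: "u * h + v * k + smult p w = 1"
    have hk: "ev h * ev k = of_int p * ev (- t)"
      using arg_cong[OF f, of ev] root by (simp add: hom_distribs add_eq_0_iff2)
    \<comment> \<open>Multiplying the relation by \<open>h\<close> and using that \<open>p\<close>
      divides \<open>h k\<close> at \<open>\<theta>\<close> gives \<open>h = u h^2\<close> modulo
      \<open>p\<close>. Iteration gives \<open>h = u^j h^(j+1)\<close>, and nilpotency then makes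
      \<open>p\<close> divide the monic \<open>h\<close>.\<close>
    have "ev h = ev (h * (u * h + v * k + smult p w))"
      by (simp add: *)
    also have "\<dots> = ev u * ev h ^ 2 + ev v * (ev h * ev k) + of_int p * (ev w * ev h)"
      by (simp add: hom_distribs algebra_simps power2_eq_square)
    also have "\<dots> = ev u * ev h ^ 2 + of_int p * ev (w * h - v * t)"
      unfolding hk by (simp add: hom_distribs algebra_simps)
    finally have step: "ev h = ev u * ev h ^ 2 + of_int p * ev (w * h - v * t)" .
    have iter: "\<exists>z. ev h = ev u ^ j * ev h ^ Suc j + of_int p * ev z" for j
    proof (induction j)
      case 0
      show ?case by (intro exI[of _ 0]) simp
    next
      case (Suc j)
      then obtain z where z: "ev h = ev u ^ j * ev h ^ Suc j + of_int p * ev z" by blast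
      have "ev h = ev u ^ j * ev h ^ j * ev h + of_int p * ev z"
        using z by (simp add: mult_ac)
      also have "ev u ^ j * ev h ^ j * ev h = ev u ^ j * ev h ^ j * (ev u * ev h ^ 2 + of_int p * ev (w * h - v * t))"
        using step by simp
      also have "\<dots> + of_int p * ev z =
          ev u ^ Suc j * ev h ^ Suc (Suc j) + of_int p * ev (u ^ j * h ^ j * (w * h - v * t) + z)"
        by (simp add: hom_distribs algebra_simps power2_eq_square)
      finally show ?case by blast
    qed
    obtain n W where n: "n > 0" "ev h ^ n = of_int p * ev W"
      using power_ev_multiple[OF p0] hI unfolding I_def by blast
    then obtain j where j: "n = Suc j"
      using gr0_implies_Suc by blast
    obtain z where "ev h = ev u ^ j * ev h ^ n + of_int p * ev z"
      using iter[of j] unfolding j by blast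
    hence "ev h = of_int p * ev (u ^ j * W + z)"
      unfolding n(2) by (simp add: hom_distribs algebra_simps)
    hence "[:p:] dvd h"
      by (intro const_dvd_if_ev_multiple \<open>degree h < degree f\<close>)
    hence "p dvd lead_coeff h"
      by (simp add: const_poly_dvd_iff)
    thus False
      using p1 monic_h by simp
  qed
  with that[OF p f] hI show ?thesis
    by (simp add: I_def)
qed

text \<open>The derivative is clear from the product rule. For \<open>p ^ 2\<close>, write
  \<open>f = (x - c) q + f(c)\<close>: modulo \<open>p\<close>, \<open>q\<close> is a multiple of
  \<open>h\<close>, so \<open>y = ev q / p\<close> is integral. With \<open>f(c) = p u\<close> we
  have \<open>(\<theta> - c) y = - u\<close>, and the integral equation of \<open>y\<close> forces
  \<open>p\<close> to divide \<open>u\<close>.\<close>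

lemma double_root_if_common_root:
  assumes p: "prime p" and f: "f = h * k + smult p t"
    and h: "algebraic_int (ev h / of_int p)"
    and hc: "p dvd poly h c" and kc: "p dvd poly k c"
  shows "p ^ 2 dvd poly f c" and "p dvd poly (pderiv f) c"
proof -
  have p0: "p \<noteq> 0" and p1: "\<not> p dvd 1"
    using p by (auto simp: not_prime_unit)
  show "p dvd poly (pderiv f) c"
    unfolding f using hc kc by (simp add: pderiv_add pderiv_mult pderiv_smult)
  have "p dvd poly f c"
    unfolding f using hc by simp
  then obtain u where u: "poly f c = p * u" by blast
  define q where "q = synthetic_div f c"
  define k1 where "k1 = synthetic_div k c"
  have q: "[:- c, 1:] * q = f - [:poly f c:]"
    using synthetic_div_correct'[of c f] by (simp add: q_def eq_diff_eq)
  have k1: "[:- c, 1:] * k1 = k - [:poly k c:]"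
    using synthetic_div_correct'[of c k] by (simp add: k1_def eq_diff_eq)
  have "[:- c, 1:] * (q - h * k1) = [:- c, 1:] * q - h * ([:- c, 1:] * k1)"
    by (simp only: right_diff_distrib mult.left_commute)
  also have "\<dots> = smult p t - [:p * u:] + smult (poly k c) h"
    unfolding q k1 u by (subst f) (simp add: algebra_simps)
  also have "[:p:] dvd \<dots>"
    using kc by (auto simp: const_poly_dvd_iff coeff_pCons split: nat.splits)
  finally have "[:p:] dvd [:- c, 1:] * (q - h * k1)" .
  moreover have "\<not> [:p:] dvd [:- c, 1:]"
    using p1 by (auto simp: const_poly_dvd_iff coeff_pCons split: nat.splits intro!: exI[of _ 1])
  \<comment> \<open>Gauss: \<open>p\<close> stays prime among integer polynomials, so it divides the
    factor other than \<open>x - c\<close>.\<close>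
  moreover have "prime_elem [:p:]"
    unfolding prime_elem_const_poly_iff using p by (rule prime_imp_prime_elem)
  ultimately have "[:p:] dvd q - h * k1"
    using prime_elem_dvd_mult_iff by blast
  then obtain w where "q - h * k1 = smult p w"
    by (auto elim!: dvdE)
  hence q_eq: "q = h * k1 + smult p w"
    by (simp add: algebra_simps)
  define y where "y = ev q / of_int p"
  have "y = ev h / of_int p * ev k1 + ev w"
    unfolding y_def q_eq using p0 by (simp add: hom_distribs field_simps)
  hence "algebraic_int y"
    using h by (simp only:) (intro algebraic_int_plus algebraic_int_times algebraic_int_int_poly algebraic_int_\<theta>)
  then obtain P where P: "poly (map_poly of_int P) y = 0" "lead_coeff P = 1"
    unfolding algebraic_int_altdef_ipoly by blast
  have "(\<theta> - of_int c) * ev q = - of_int (p * u)"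
    using arg_cong[OF q, of ev] root u by (simp add: hom_distribs algebra_simps)
  hence yu: "(\<theta> - of_int c) * y = - of_int u"
    using p0 by (simp add: y_def field_simps)
  define n where "n = degree P"
  \<comment> \<open>The homogenization of \<open>P\<close> at \<open>(- u, x - c)\<close>: its value
    at \<open>\<theta>\<close> is \<open>(\<theta> - c) ^ n\<close> times \<open>P\<close> at
    \<open>y\<close>, hence 0.\<close>
  define R where "R = (\<Sum>i\<le>n. smult (coeff P i * (- u) ^ i) ([:- c, 1:] ^ (n - i)))"
  have "ev R = (\<Sum>i\<le>n. of_int (coeff P i) * (- of_int u) ^ i * (\<theta> - of_int c) ^ (n - i))"
    by (simp add: R_def hom_distribs poly_sum algebra_simps)
  also have "\<dots> = (\<Sum>i\<le>n. of_int (coeff P i) * y ^ i * (\<theta> - of_int c) ^ n)"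
    unfolding yu[symmetric]
    by (intro sum.cong refl) (simp add: power_mult_distrib mult_ac flip: power_add)
  also have "\<dots> = poly (map_poly of_int P) y * (\<theta> - of_int c) ^ n"
    by (simp add: poly_altdef n_def sum_distrib_right)
  also have "\<dots> = 0"
    using P by simp
  finally have "f dvd R"
    by (simp only: ev_eq_0_iff)
  hence "poly f c dvd poly R c"
    by (auto elim!: dvdE)
  also have "poly R c = (\<Sum>i\<le>n. coeff P i * (- u) ^ i * 0 ^ (n - i))"
    by (simp add: R_def poly_sum)
  \<comment> \<open>Only the top term survives, with \<open>0 ^ 0 = 1\<close> and leading
    coefficient 1.\<close>
  also have "\<dots> = (\<Sum>i\<in>{n}. coeff P i * (- u) ^ i * 0 ^ (n - i))"
    by (rule sum.mono_neutral_right) auto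
  also have "\<dots> = (- u) ^ n"
    using P by (simp add: n_def)
  finally have "p dvd (- u) ^ n"
    unfolding u by (rule dvd_mult_left)
  hence "p dvd - u"
    using prime_dvd_power[OF p] by blast
  hence "p dvd u"
    by simp
  thus "p ^ 2 dvd poly f c"
    by (simp add: u power2_eq_square)
qed

end

section \<open>The quintic trinomial\<close>

text \<open>Eliminate \<open>a\<close> and \<open>b\<close> in favour of \<open>s\<close>,
  \<open>t\<close> and \<open>C = c ^ 4\<close>. In the part free of \<open>t\<close>, the constant
  and linear terms in \<open>s\<close> cancel, and \<open>B\<close> is its quotient by
  \<open>s ^ 2\<close>.\<close>

lemma quintic_discriminant_combination:
  fixes a b c :: int
  defines "s \<equiv> 5 * c ^ 4 + a" and "t \<equiv> c ^ 5 + a * c + b"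
  shows "\<exists>A B. 2 ^ 8 * a ^ 5 + 5 ^ 5 * b ^ 4 = A * t + B * s ^ 2"
proof -
  define C where "C = c ^ 4"
  define y where "y = c * (4 * C - s)"
  have a: "a = s - 5 * C" and b: "b = t + y"
    by (simp_all add: s_def t_def C_def y_def algebra_simps eval_nat_numeral)
  define A where "A = t ^ 3 + 4 * t ^ 2 * y + 6 * t * y ^ 2 + 4 * y ^ 3"
  define B where "B = 256 * s ^ 3 - 3275 * C * s ^ 2 + 14000 * C ^ 2 * s - 20000 * C ^ 3"
  have "(t + y) ^ 4 = A * t + y ^ 4"
    by (simp add: A_def algebra_simps eval_nat_numeral)
  hence "2 ^ 8 * a ^ 5 + 5 ^ 5 * b ^ 4 = 5 ^ 5 * A * t + (2 ^ 8 * (s - 5 * C) ^ 5 + 5 ^ 5 * y ^ 4)"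
    unfolding a b by (simp only: distrib_left mult.assoc add_ac)
  also have "y ^ 4 = C * (4 * C - s) ^ 4"
    by (simp add: y_def C_def power_mult_distrib)
  also have "2 ^ 8 * (s - 5 * C) ^ 5 + 5 ^ 5 * (C * (4 * C - s) ^ 4) = B * s ^ 2"
    by (simp add: B_def algebra_simps eval_nat_numeral)
  finally show ?thesis by blast
qed

text \<open>By the previous identity \<open>p ^ 2\<close> divides the discriminant. If
  \<open>p\<close> did not divide \<open>gcd (2 * a) (5 * b)\<close>, it would be coprime to the gcd
  \<open>G\<close> that is divided out, so \<open>p ^ 2\<close> would divide the square-free
  quotient.\<close>

lemma quintic_double_root_prime:
  fixes a b c p :: int
  assumes p: "prime p" and fc: "p ^ 2 dvd c ^ 5 + a * c + b" and f'c: "p dvd 5 * c ^ 4 + a"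
    and sqf: "squarefree ((2 ^ 8 * a ^ 5 + 5 ^ 5 * b ^ 4) div gcd (2 ^ 8 * a ^ 5) (5 ^ 5 * b ^ 4))"
  shows "p dvd gcd (2 * a) (5 * b)"
proof (rule ccontr)
  assume *: "\<not> p dvd gcd (2 * a) (5 * b)"
  define G where "G = gcd (2 ^ 8 * a ^ 5) (5 ^ 5 * b ^ 4)"
  define E where "E = (2 ^ 8 * a ^ 5 + 5 ^ 5 * b ^ 4) div G"
  have "\<not> p dvd G"
  proof
    assume "p dvd G"
    hence "p dvd 2 ^ 8 * a ^ 5" "p dvd 5 ^ 5 * b ^ 4"
      unfolding G_def by (simp_all only: gcd_greatest_iff)
    hence "p dvd 2 * a" "p dvd 5 * b"
      using p by (auto simp only: prime_dvd_mult_iff dest: prime_dvd_power)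
    with * show False
      using gcd_greatest by blast
  qed
  hence cop: "Rings.coprime (p ^ 2) G"
    using prime_imp_coprime[OF p] by simp
  have GE: "2 ^ 8 * a ^ 5 + 5 ^ 5 * b ^ 4 = G * E"
    unfolding E_def G_def by (rule dvd_mult_div_cancel[symmetric]) (intro dvd_add gcd_dvd1 gcd_dvd2)
  obtain A B where "2 ^ 8 * a ^ 5 + 5 ^ 5 * b ^ 4 = A * (c ^ 5 + a * c + b) + B * (5 * c ^ 4 + a) ^ 2"
    using quintic_discriminant_combination by blast
  hence "p ^ 2 dvd G * E"
    unfolding GE using fc dvd_power_same[OF f'c, of 2] by simp
  hence "p ^ 2 dvd E"
    using cop by (simp add: coprime_dvd_mult_right_iff)
  hence "is_unit p"
    using sqf unfolding E_def G_def by (rule squarefreeD[rotated])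
  with p show False
    using not_prime_unit by blast
qed

text \<open>Here \<open>p\<close> divides \<open>a\<close> unless \<open>p = 2\<close>, and
  \<open>b\<close> unless \<open>p = 5\<close>, so few residues \<open>c\<close> matter: 0 if
  \<open>p\<close> divides both, an odd \<open>c\<close> if \<open>p = 2\<close> and
  \<open>a\<close> is odd, and a nonzero residue modulo 5 if 5 divides \<open>a\<close> but not
  \<open>b\<close>.\<close>

lemma quintic_double_root_conditions:
  fixes a b p :: int
  assumes p: "prime p" and gcd: "p dvd gcd (2 * a) (5 * b)"
  shows "(\<exists>c. p ^ 2 dvd c ^ 5 + a * c + b \<and> p dvd 5 * c ^ 4 + a) \<longleftrightarrow>
    \<not> ((p dvd a \<and> p dvd b \<and> \<not> p ^ 2 dvd b)
     \<or> (p = 2 \<and> \<not> 2 dvd a \<and> [a + b = 1] (mod 4))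
     \<or> (p = 5 \<and> \<not> 5 dvd b \<and> \<not> [b = 1 + a] (mod 25) \<and> \<not> [b = 7 + 2 * a] (mod 25)
          \<and> \<not> [b = 18 + 3 * a] (mod 25) \<and> \<not> [b = 24 + 4 * a] (mod 25)))"
    (is "?L \<longleftrightarrow> \<not> ?R")
proof -
  have pa: "p dvd 2 * a" and pb: "p dvd 5 * b"
    using gcd by auto
  have p2: "p = 2" if "\<not> p dvd a"
    using pa p that primes_dvd_imp_eq[OF p, of 2] by (simp add: prime_dvd_mult_iff)
  have p5: "p = 5" if "\<not> p dvd b"
    using pb p that primes_dvd_imp_eq[OF p, of 5] by (simp add: prime_dvd_mult_iff)
  have False if ?L ?R
  proof -
    from \<open>?L\<close> obtain c where c: "p ^ 2 dvd c ^ 5 + a * c + b" "p dvd 5 * c ^ 4 + a"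
      by blast
    from \<open>?R\<close> consider "p dvd a" "p dvd b" "\<not> p ^ 2 dvd b"
      | "p = 2" "\<not> 2 dvd a" "[a + b = 1] (mod 4)"
      | "p = 5" "\<not> 5 dvd b" "\<not> [b = 1 + a] (mod 25)" "\<not> [b = 7 + 2 * a] (mod 25)"
          "\<not> [b = 18 + 3 * a] (mod 25)" "\<not> [b = 24 + 4 * a] (mod 25)"
      by blast
    thus False
    proof cases
      case 1
      have "p dvd c ^ 5 + (a * c + b)"
        using dvd_trans[OF dvd_power[of 2 p] c(1)] by (simp add: add.assoc)
      moreover have "p dvd a * c + b"
        using 1 by simp
      ultimately have "p dvd c ^ 5"
        by (simp only: dvd_add_left_iff)
      hence "p dvd c"
        using prime_dvd_power[OF p] by blast
      hence "p ^ 2 dvd c ^ 5" "p ^ 2 dvd a * c"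
        using 1 dvd_power_le[of p c 2 5] by (auto simp: power2_eq_square intro: mult_dvd_mono)
      hence "p ^ 2 dvd c ^ 5 + a * c"
        by (rule dvd_add)
      hence "p ^ 2 dvd b"
        using c(1) by (simp only: dvd_add_right_iff)
      with 1 show False by blast
    next
      case 2
      hence "odd c"
        using c(2) by auto
      then obtain j where j: "c = 2 * j + 1"
        by (auto elim: oddE)
      obtain i where i: "a = 2 * i + 1"
        using 2 by (auto elim: oddE)
      \<comment> \<open>For odd \<open>a\<close> and \<open>c\<close> the value modulo 4 does not
        depend on \<open>c\<close>.\<close>
      have "c ^ 5 + a * c + b = (a + b + 1) + 4 * (8 * j ^ 5 + 20 * j ^ 4 + 20 * j ^ 3 + 10 * j ^ 2 + 3 * j + i * j)"
        unfolding j i by (simp add: algebra_simps eval_nat_numeral)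
      hence "4 dvd a + b + 1"
        using c(1) 2 by (metis dvd_add_left_iff dvd_triv_left power2_eq_square mult_2 numeral_Bit0)
      with 2 show False
        unfolding cong_def by presburger
    next
      case 3
      then obtain i where i: "a = 5 * i"
        using p2 by (metis dvdE numeral_eq_iff semiring_norm(88))
      \<comment> \<open>As 5 divides \<open>a\<close>, the value \<open>f(c)\<close> modulo 25
        depends only on \<open>c\<close> modulo 5.\<close>
      define r j where "r = c mod 5" and "j = c div 5"
      have cr: "c = 5 * j + r"
        by (simp add: r_def j_def)
      have "25 dvd c ^ 5 + a * c + b"
        using c(1) 3 by simp
      also have "c ^ 5 + a * c + b = (r ^ 5 + a * r + b) +
          25 * (125 * j ^ 5 + 125 * j ^ 4 * r + 50 * j ^ 3 * r ^ 2 + 10 * j ^ 2 * r ^ 3 + j * r ^ 4 + i * j)"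
        unfolding cr i by (simp add: algebra_simps eval_nat_numeral)
      finally have 25: "25 dvd r ^ 5 + a * r + b"
        by (simp only: dvd_add_left_iff dvd_triv_left)
      have "r \<in> {0, 1, 2, 3, 4}"
        unfolding r_def by auto
      then consider "r = 0" | "r = 1" | "r = 2" | "r = 3" | "r = 4"
        by blast
      hence "5 dvd b \<or> 25 dvd b - (1 + a) \<or> 25 dvd b - (7 + 2 * a)
          \<or> 25 dvd b - (18 + 3 * a) \<or> 25 dvd b - (24 + 4 * a)"
      proof cases
        case 1
        with 25 have "25 dvd b" by simp
        hence "5 dvd b" by (rule dvd_trans[rotated]) simp
        thus ?thesis by blast
      next
        case 2
        hence "b - (24 + 4 * a) = r ^ 5 + a * r + b - 25 * (1 + i)"
          by (simp add: i)
        with 25 show ?thesis by (metis dvd_diff dvd_triv_left)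
      next
        case 3
        hence "b - (18 + 3 * a) = r ^ 5 + a * r + b - 25 * (2 + i)"
          by (simp add: i)
        with 25 show ?thesis by (metis dvd_diff dvd_triv_left)
      next
        case 4
        hence "b - (7 + 2 * a) = r ^ 5 + a * r + b - 25 * (10 + i)"
          by (simp add: i)
        with 25 show ?thesis by (metis dvd_diff dvd_triv_left)
      next
        case 5
        hence "b - (1 + a) = r ^ 5 + a * r + b - 25 * (41 + i)"
          by (simp add: i)
        with 25 show ?thesis by (metis dvd_diff dvd_triv_left)
      qed
      hence "5 dvd b \<or> [b = 1 + a] (mod 25) \<or> [b = 7 + 2 * a] (mod 25)
          \<or> [b = 18 + 3 * a] (mod 25) \<or> [b = 24 + 4 * a] (mod 25)"
        by (simp only: cong_iff_dvd_diff)
      with 3 show False by blast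
    qed
  qed
  moreover have ?L if "\<not> ?R"
  proof (cases "p dvd a")
    case True
    show ?thesis
    proof (cases "p dvd b")
      case pb: True
      with True that show ?thesis
        by (intro exI[of _ 0]) auto
    next
      case False
      hence [simp]: "p = 5"
        by (rule p5)
      from True obtain i where i: "a = 5 * i"
        by auto
      have "25 dvd b - (1 + a) \<or> 25 dvd b - (7 + 2 * a) \<or> 25 dvd b - (18 + 3 * a) \<or> 25 dvd b - (24 + 4 * a)"
        using that False unfolding cong_iff_dvd_diff by auto
      \<comment> \<open>The four congruences say that -1, -2, -3, -4 are roots of \<open>f\<close>
        modulo 25; the corrections reduce 32, 243 and 1024 to 7, 18 and 24.\<close>
      hence "25 dvd (-1) ^ 5 + a * (-1) + b \<or> 25 dvd (-2) ^ 5 + a * (-2) + b - 25 * (- 1)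
          \<or> 25 dvd (-3) ^ 5 + a * (-3) + b - 25 * (- 9) \<or> 25 dvd (-4) ^ 5 + a * (-4) + b - 25 * (- 40)"
        by (simp add: algebra_simps)
      hence "25 dvd (-1) ^ 5 + a * (-1) + b \<or> 25 dvd (-2) ^ 5 + a * (-2) + b
          \<or> 25 dvd (-3) ^ 5 + a * (-3) + b \<or> 25 dvd (-4) ^ 5 + a * (-4) + b"
        by (simp only: dvd_diff_left_iff dvd_triv_left)
      then obtain c where "25 dvd c ^ 5 + a * c + b"
        by blast
      moreover have "5 dvd 5 * c ^ 4 + a"
        using i by simp
      ultimately show ?thesis
        by (intro exI[of _ c]) simp
    qed
  next
    case False
    hence [simp]: "p = 2"
      by (rule p2)
    have "even b" "odd a" "\<not> [a + b = 1] (mod 4)"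
      using pb False that by auto
    hence "4 dvd - 1 - a + b" "2 dvd 5 + a"
      unfolding cong_def by presburger+
    thus ?thesis
      by (intro exI[of _ "-1"]) simp
  qed
  ultimately show ?thesis by blast
qed

section \<open>Maximality of the order of the quintic\<close>

lemma quintic_maximal_iff:
  fixes a b :: int and \<theta> :: complex
  assumes irr: "irreducible ([:b, a, 0, 0, 0, 1:] :: int poly)"
    and root: "poly (map_poly of_int [:b, a, 0, 0, 0, 1:]) \<theta> = 0"
  shows "int_adjoin \<theta> = ring_of_integers (rat_field_adjoin \<theta>) \<longleftrightarrow>
    \<not> (\<exists>p c. prime p \<and> p ^ 2 dvd c ^ 5 + a * c + b \<and> p dvd 5 * c ^ 4 + a)"
proof -
  define f where "f = [:b, a, 0, 0, 0, 1:]"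
  interpret monic_irreducible_root f \<theta>
    using assms by unfold_locales (simp_all add: f_def)
  have fc: "poly f c = c ^ 5 + a * c + b" for c
    by (simp add: f_def algebra_simps eval_nat_numeral)
  have f': "pderiv f = [:a, 0, 0, 0, 5:]"
    by (simp add: f_def pderiv_pCons)
  have f'c: "poly (pderiv f) c = 5 * c ^ 4 + a" for c
    by (simp add: f' algebra_simps eval_nat_numeral)
  have "\<exists>p c. prime p \<and> p ^ 2 dvd poly f c \<and> p dvd poly (pderiv f) c"
    if not_max: "int_adjoin \<theta> \<noteq> ring_of_integers (rat_field_adjoin \<theta>)"
  proof -
    obtain p h k t where p: "prime p" and hk: "f = h * k + smult p t"
      and h: "algebraic_int (ev h / of_int p)"
      and proper: "\<forall>u v w. u * h + v * k + smult p w \<noteq> 1"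
      using not_maximal_factorization[OF not_max] .
    note common_root = ex_common_root_mod_prime[OF p proper]
    \<comment> \<open>Both \<open>f\<close> and \<open>f'\<close> lie in \<open>(p, h, k)\<close>,
      and this combination of them cancels the \<open>x^5\<close> terms. What remains is to find a
      product of linear factors in the ideal.\<close>
    have "[:5 * b, 4 * a:] = 5 * f - [:0, 1:] * pderiv f"
      unfolding f' by (simp add: f_def numeral_poly)
    also have "\<dots> = (5 * k - [:0, 1:] * pderiv k) * h + (- [:0, 1:] * pderiv h) * k +
        smult p (5 * t - [:0, 1:] * pderiv t)"
      unfolding hk by (simp add: pderiv_add pderiv_mult pderiv_smult algebra_simps smult_diff_right)
    finally obtain u v w where "[:5 * b, 4 * a:] = u * h + v * k + smult p w"
      by blast
    hence linear: "smult e [:5 * b, 4 * a:] + smult p m =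
        smult e u * h + smult e v * k + smult p (smult e w + m)" for e m
      by (simp only: smult_add_right mult_smult_left smult_smult mult.commute[of e] add.assoc)
    have split: "\<exists>c. p dvd poly h c \<and> p dvd poly k c"
      if "f = (\<Prod>c\<leftarrow>cs. [:- c, 1:]) + smult p m" for cs m
    proof -
      have "(\<Prod>c\<leftarrow>cs. [:- c, 1:]) = f - smult p m"
        using that by simp
      also have "\<dots> = k * h + 0 * k + smult p (t - m)"
        unfolding hk by (simp add: smult_diff_right mult.commute)
      finally show ?thesis
        using common_root by blast
    qed
    have "\<exists>c. p dvd poly h c \<and> p dvd poly k c"
    proof (cases "p dvd 2 * a")
      case False
      \<comment> \<open>Since \<open>4 * a\<close> is invertible modulo \<open>p\<close>, the linear
        polynomial itself yields the single factor \<open>x + 5 * b * e\<close>.\<close>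
      hence "\<not> p dvd 2 * (2 * a)"
        using p by (auto simp only: prime_dvd_mult_iff)
      then obtain e d where "e * (2 * (2 * a)) + d * p = 1"
        by (rule prime_bezout_int[OF p])
      hence "[:5 * b * e, 1:] = smult e [:5 * b, 4 * a:] + smult p [:0, d:]"
        by (simp add: mult_ac)
      hence "(\<Prod>c\<leftarrow>[- 5 * b * e]. [:- c, 1:]) = smult e [:5 * b, 4 * a:] + smult p [:0, d:]"
        by simp
      thus ?thesis
        unfolding linear using common_root by blast
    next
      case pa: True
      \<comment> \<open>Otherwise the linear polynomial is a unit constant modulo \<open>p\<close>,
        against properness. From here on \<open>f\<close> splits modulo \<open>p\<close>: as
        \<open>x^5\<close>, as \<open>(x + b)^5\<close> for \<open>p = 5\<close>, or as
        \<open>x (x + 1)^4\<close> for \<open>p = 2\<close>.\<close>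
      have pb: "p dvd 5 * b"
      proof (rule ccontr)
        assume "\<not> p dvd 5 * b"
        then obtain e d where ed: "e * (5 * b) + d * p = 1"
          by (rule prime_bezout_int[OF p])
        obtain i where "2 * a = p * i"
          using pa by blast
        hence "4 * a = p * (2 * i)"
          by simp
        hence "smult e [:5 * b, 4 * a:] + smult p [:d, - e * (2 * i):] = 1"
          using ed by (simp add: mult_ac one_pCons)
        thus False
          unfolding linear using proper by blast
      qed
      show ?thesis
      proof (cases "p dvd a")
        case True
        then obtain i where i: "a = p * i" by blast
        show ?thesis
        proof (cases "p dvd b")
          case True
          then obtain j where j: "b = p * j" by blast
          show ?thesis
            by (rule split[of "[0, 0, 0, 0, 0]" "[:j, i:]"]) (simp add: f_def i j)
        next
          case False
          hence [simp]: "p = 5"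
            using pb p primes_dvd_imp_eq[OF p, of 5] by (simp add: prime_dvd_mult_iff)
          define r where "r = b mod 5"
          \<comment> \<open>Fermat's little theorem for 5, checked on residues.\<close>
          have "r \<in> {0, 1, 2, 3, 4}"
            unfolding r_def by auto
          hence "r ^ 5 mod 5 = r"
            by auto
          hence "b mod 5 = b ^ 5 mod 5"
            unfolding r_def power_mod by simp
          then obtain j where "b - b ^ 5 = 5 * j"
            by (auto simp only: mod_eq_dvd_iff elim: dvdE)
          hence j: "b = b ^ 5 + 5 * j"
            by simp
          show ?thesis
          proof (rule split[of "[- b, - b, - b, - b, - b]" "[:j, i - b ^ 4, - 2 * b ^ 3, - 2 * b ^ 2, - b:]"])
            show "f = (\<Prod>c\<leftarrow>[- b, - b, - b, - b, - b]. [:- c, 1:]) +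
                smult p [:j, i - b ^ 4, - 2 * b ^ 3, - 2 * b ^ 2, - b:]"
              using j by (simp add: f_def i algebra_simps eval_nat_numeral)
          qed
        qed
      next
        case False
        hence [simp]: "p = 2"
          using pa p primes_dvd_imp_eq[OF p, of 2] by (simp add: prime_dvd_mult_iff)
        obtain j where j: "b = 2 * j"
          using pb by auto
        obtain i where i: "a = 2 * i + 1"
          using False by (auto elim: oddE)
        show ?thesis
          by (rule split[of "[0, - 1, - 1, - 1, - 1]" "[:j, i, - 2, - 3, - 2:]"]) (simp add: f_def i j)
      qed
    qed
    thus ?thesis
      using double_root_if_common_root[OF p hk h] p by blast
  qed
  moreover have "int_adjoin \<theta> \<noteq> ring_of_integers (rat_field_adjoin \<theta>)"
    if "prime p" "p ^ 2 dvd poly f c" "p dvd poly (pderiv f) c" for p c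
    using not_maximal_if_double_root that .
  ultimately show ?thesis
    unfolding fc f'c by blast
qed

theorem theorem3p1:
  fixes a b :: int and \<theta> :: complex
  assumes irr: "irreducible ([:b, a, 0, 0, 0, 1:] :: int poly)"
    and root: "poly (map_poly of_int [:b, a, 0, 0, 0, 1:]) \<theta> = 0"
    and sqf: "squarefree ((2^8 * a^5 + 5^5 * b^4) div gcd (2^8 * a^5) (5^5 * b^4))"
  shows "int_adjoin \<theta> = ring_of_integers (rat_field_adjoin \<theta>) \<longleftrightarrow>
    (\<forall>p :: nat. prime p \<and> int p dvd gcd (2 * a) (5 * b) \<longrightarrow>
       (int p dvd a \<and> int p dvd b \<and> \<not> int p ^ 2 dvd b)
     \<or> (p = 2 \<and> \<not> 2 dvd a \<and> [a + b = 1] (mod 4))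
     \<or> (p = 5 \<and> \<not> 5 dvd b \<and> \<not> [b = 1 + a] (mod 25) \<and> \<not> [b = 7 + 2 * a] (mod 25)
          \<and> \<not> [b = 18 + 3 * a] (mod 25) \<and> \<not> [b = 24 + 4 * a] (mod 25)))"
proof -
  define D where "D p \<longleftrightarrow> (\<exists>c. p ^ 2 dvd c ^ 5 + a * c + b \<and> p dvd 5 * c ^ 4 + a)" for p :: int
  \<comment> \<open>Square-freeness confines the primes with a double root to divisors of the gcd;
    \<open>nat\<close> passes to the natural primes of the statement.\<close>
  have D: "prime (int (nat p)) \<and> int (nat p) dvd gcd (2 * a) (5 * b) \<and> D (int (nat p))"
    if "prime p" "D p" for p
    using quintic_double_root_prime[OF that(1) _ _ sqf] that prime_ge_0_int[OF that(1)]
    unfolding D_def by auto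
  have "int_adjoin \<theta> = ring_of_integers (rat_field_adjoin \<theta>) \<longleftrightarrow> (\<forall>p. prime p \<longrightarrow> \<not> D p)"
    unfolding quintic_maximal_iff[OF irr root] D_def by blast
  also have "\<dots> \<longleftrightarrow> (\<forall>p. prime (int p) \<and> int p dvd gcd (2 * a) (5 * b) \<longrightarrow> \<not> D (int p))"
    using D by blast
  also have "\<dots> \<longleftrightarrow> (\<forall>p. prime p \<and> int p dvd gcd (2 * a) (5 * b) \<longrightarrow>
       (int p dvd a \<and> int p dvd b \<and> \<not> int p ^ 2 dvd b)
     \<or> (p = 2 \<and> \<not> 2 dvd a \<and> [a + b = 1] (mod 4))
     \<or> (p = 5 \<and> \<not> 5 dvd b \<and> \<not> [b = 1 + a] (mod 25) \<and> \<not> [b = 7 + 2 * a] (mod 25)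
          \<and> \<not> [b = 18 + 3 * a] (mod 25) \<and> \<not> [b = 24 + 4 * a] (mod 25)))"
    (is "_ \<longleftrightarrow> (\<forall>p. ?P p \<longrightarrow> ?Q p)")
  proof -
    have "\<not> D (int p) \<longleftrightarrow> ?Q p" if "?P p" for p
    proof -
      have "int p = 2 \<longleftrightarrow> p = 2" "int p = 5 \<longleftrightarrow> p = 5"
        by auto
      moreover have "prime (int p)"
        using that by simp
      ultimately show ?thesis
        using quintic_double_root_conditions[of "int p" a b] that unfolding D_def by blast
    qed
    thus ?thesis
      unfolding prime_int_nat_transfer by auto
  qed
  finally show ?thesis .
qed

end
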